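(* Let $p,q,r,s$ be integers with $r,s>0$, $r+s<q-1$ and $r+s\leq p-2$. Let $K=\mathrm S(\mathrm{GL}(p)\times\mathrm{GL}(q))$, let $Ke\subset\mathfrak p$ be the spherical nilpotent $K$-orbit with signed partition $(+3,+2^r,-2^s,+1^{p-r-s-2},-1^{q-r-s-1})$, and let $X$ be the wonderful compactification of $K/\mathrm N_K(K_e)$, with set of spherical roots $\Sigma$ and set of colors $\Delta$. Put $r_1=r$, $r_2=s$. The semigroup $$\Gamma_{\Delta_{\mathfrak p}(e)}=\{(n_1,n_2,E)\in\mathbb N^2\times\mathbb N\Delta : E\leq_\Sigma n_1D_{\mathfrak p_1}+n_2D_{\mathfrak p_2}\}$$ is generated by the elements $(i,0,\tilde D^1_{2i})$ for $1\leq i\leq r_1+1$, $(0,j,\tilde D^2_{2j})$ for $1\leq j\leq r_2+1$, and $(i,j,\tilde D^1_{2i-1}+\tilde D^2_{2j-1})$ for $1\leq i\leq r_1+1$, $1\leq j\leq r_2+1$.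
   Context: Everything is over $\mathbb C$; $\mathbb N$ contains $0$. Let $G=\mathrm{SL}(p+q)\supset K$. Let $e_1,\dots,e_p$ be a basis of $\mathbb C^p$ with dual basis $\varphi_1,\dots,\varphi_p$, and $e'_1,\dots,e'_q$ a basis of $\mathbb C^q$ with dual basis $\varphi'_1,\dots,\varphi'_q$. The isotropy representation is $\mathfrak p=\mathfrak p_1\oplus\mathfrak p_2$, $\mathfrak p_1=\mathbb C^p\otimes(\mathbb C^q)^*$, $\mathfrak p_2=(\mathbb C^p)^*\otimes\mathbb C^q$. A representative of the orbit is $$e=e_1\otimes\varphi'_{q-r}+\sum_{i=1}^re_{i+1}\otimes\varphi'_{q-r+i}+\sum_{i=1}^s\varphi_{p-s+i-1}\otimes e'_i+\varphi_p\otimes e'_{q-r}.$$ Let $B\subset K$ be the standard Borel subgroup; $\alpha_1,\dots,\alpha_{p-1}$ and $\alpha'_1,\dots,\alpha'_{q-1}$ are the simple roots of $\mathrm{GL}(p)$ and $\mathrm{GL}(q)$. A wonderful $K$-variety is a smooth projective $K$-variety with an open $K$-orbit whose complement is a union of smooth prime divisors with normal crossings and non-empty total intersection, such that two points are in the same orbit if and only if they lie in the same boundary divisors. The homogeneous space $K/\mathrm N_K(K_e)$ is the open orbit of a unique wonderful $K$-variety $X$. Its set of colors $\Delta$ is the set of $B$-stable, non-$K$-stable prime divisors; $\mathrm{Pic}(X)=\mathbb Z\Delta$, writing $\mathcal L_D$ for the line bundle of $D$, and $\mathbb N\Delta$ corresponds to the globally generated line bundles. The set of spherical roots $\Sigma$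 is the set of $T$-weights on $\mathrm T_{y_0}X/\mathrm T_{y_0}Y$, with $T\subset B$ the maximal torus, $Y$ the closed orbit and $y_0\in Y$ the point fixed by the opposite Borel subgroup; spherical roots correspond bijectively to $K$-stable prime divisors, so that $\mathbb Z\Sigma\subset\mathrm{Pic}(X)=\mathbb Z\Delta$. For $D,E\in\mathbb N\Delta$, $D\leq_\Sigma E$ means $E-D\in\mathbb N\Sigma$. A simple root $\alpha$ moves a color $D$ if $P_\alpha D\neq D$, where $P_\alpha\supset B$ is the minimal parabolic subgroup of $\alpha$. Here $\Sigma=\{\sigma^1_1,\dots,\sigma^1_{2r},\sigma^2_1,\dots,\sigma^2_{2s},\tau\}$ with $\sigma^1_{2i-1}=\alpha_{p-i}$, $\sigma^1_{2i}=\alpha'_i$ ($1\leq i\leq r$), $\sigma^2_{2i-1}=\alpha_i$, $\sigma^2_{2i}=\alpha'_{q-i}$ ($1\leq i\leq s$), $\tau=\alpha'_{r+1}+\dots+\alpha'_{q-s-1}$. The colors are $\Delta=\{D^1_1,\dots,D^1_{2r_1+3},D^2_1,\dots,D^2_{2r_2+3}\}$, where for $k=1,2$: $D^k_1$ is the color moved by $\sigma^k_1$ only; $D^k_h$ ($2\leq h\leq2r_k$) is the color moved by $\sigma^k_{h-1}$ and $\sigma^k_h$; $D^k_{2r_k+1}$ is the color moved by $\sigma^k_{2r_k}$ only; $D^1_{2r+2}$ is the color moved by $\alpha_{p-r-1}$ and $D^2_{2s+2}$ the color moved by $\alpha_{s+1}$ (these two coincide if $p=r+s+2$, and otherwise all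 listed colors are distinct); if $r+s<q-2$, $D^1_{2r+3}$ and $D^2_{2s+3}$ are the colors moved by $\alpha'_{r+1}$ and $\alpha'_{q-s-1}$ respectively; if $r+s=q-2$, they are the two colors $D_\tau^+$, $D_\tau^-$ moved by the simple root $\tau=\alpha'_{r+1}=\alpha'_{q-s-1}$, labelled so that $D^1_{2r+3}$ has coefficient $-1$ in $\alpha'_r$ and $D^2_{2s+3}$ has coefficient $-1$ in $\alpha'_{q-s}$ when these spherical roots are written in $\mathbb Z\Delta$. For $k=1,2$ put $$\tilde D^k_h=D^k_h\ \text{ if } h<2r_k+1,\qquad \tilde D^k_h=D^k_h+D^k_{h+1}\ \text{ if } h\in\{2r_k+1,2r_k+2\}.$$ In $\mathbb Z\Delta$, with $\tilde D^k_0=0$, one has $\sigma^k_h=-\tilde D^k_{h-1}+\tilde D^k_h+\tilde D^k_{h+1}-\tilde D^k_{h+2}$ for $1\leq h\leq2r_k$, and $\tau=-D^1_{2r_1+1}+D^1_{2r_1+3}+D^2_{2r_2+3}-D^2_{2r_2+1}$. For $i=1,2$, $D_{\mathfrak p_i}\in\mathbb N\Delta$ is the element such that $\mathcal L_{D_{\mathfrak p_i}}$ is the pullback of $\mathcal O(1)$ along the equivariant morphism $X\to\mathbb P(\mathfrak p_i)$ extending the map induced by the projection $Ke\to\mathfrak p_i$; here $D_{\mathfrak p_1}=D^1_2$ and $D_{\mathfrak p_2}=D^2_2$. $\Delta_{\mathfrak p}(e)=\{D_{\mathfrak p_1},D_{\mathfrak p_2}\}$. *)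

theory Defs
  imports
    "HOL-Analysis.Analysis"
    "HOL-Algebra.Group_Action"
    "HOL-Library.Poly_Mapping"
    "Jordan_Normal_Form.Determinant"
begin

no_notation Matrix.vec_index (infixl "$" 100)

section \<open>Projective varieties\<close>

text \<open>
  A closed subset of the projective space of \<open>complex^'n\<close> is represented by its affine cone: a
  Zariski closed, scaling-invariant subset of \<open>complex^'n\<close>. The cone \<open>{0}\<close> is the empty
  projective set. A point of the projective space is a nonzero vector up to scaling.
\<close>

inductive_set poly_funs :: "('a \<Rightarrow> complex) set \<Rightarrow> ('a \<Rightarrow> complex) set"
  for C :: "('a \<Rightarrow> complex) set" where
  const: "(\<lambda>_. c) \<in> poly_funs C"
| gen: "f \<in> C \<Longrightarrow> f \<in> poly_funs C"
| add: "f \<in> poly_funs C \<Longrightarrow> g \<in> poly_funs C \<Longrightarrow> (\<lambda>x. f x + g x) \<in> poly_funs C"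
| mult: "f \<in> poly_funs C \<Longrightarrow> g \<in> poly_funs C \<Longrightarrow> (\<lambda>x. f x * g x) \<in> poly_funs C"

definition polys :: "(complex^'n \<Rightarrow> complex) set" where
  "polys = poly_funs (range (\<lambda>i x. x $ i))"

definition form :: "nat \<Rightarrow> (complex^'n \<Rightarrow> complex) \<Rightarrow> bool" where
  "form d f \<longleftrightarrow> f \<in> polys \<and> (\<forall>c x. f (c *s x) = c ^ d * f x)"

definition zclosed :: "(complex^'n) set \<Rightarrow> bool" where
  "zclosed Z \<longleftrightarrow> (\<exists>F \<subseteq> polys. Z = {x. \<forall>f\<in>F. f x = 0})"

definition vanishing_ideal :: "(complex^'n) set \<Rightarrow> (complex^'n \<Rightarrow> complex) set" where
  "vanishing_ideal Z = {f \<in> polys. \<forall>x\<in>Z. f x = 0}"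

definition projective_variety :: "(complex^'n) set \<Rightarrow> bool" where
  "projective_variety Z \<longleftrightarrow>
     zclosed Z \<and> (\<forall>c. \<forall>x\<in>Z. c *s x \<in> Z) \<and> \<not> Z \<subseteq> {0} \<and>
     (\<forall>A B. zclosed A \<longrightarrow> zclosed B \<longrightarrow> Z \<subseteq> A \<union> B \<longrightarrow> Z \<subseteq> A \<or> Z \<subseteq> B)"

definition pdim :: "(complex^'n) set \<Rightarrow> nat" where
  "pdim X = Sup {d. \<exists>Z. (\<forall>i\<le>d. projective_variety (Z i) \<and> Z i \<subseteq> X) \<and> (\<forall>i<d. Z i \<subset> Z (Suc i))}"

text \<open>The tangent space at \<open>x\<close> of the affine cone.\<close>

definition tangent :: "(complex^'n) set \<Rightarrow> complex^'n \<Rightarrow> (complex^'n) set" where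
  "tangent X x = {v. \<forall>f\<in>vanishing_ideal X. deriv (\<lambda>t. f (x + t *s v)) 0 = 0}"

text \<open>The cone has dimension \<open>pdim X + 1\<close>; its vertex is disregarded.\<close>

definition smooth_variety :: "(complex^'n) set \<Rightarrow> bool" where
  "smooth_variety X \<longleftrightarrow>
     projective_variety X \<and> (\<forall>x\<in>X - {0}. vec.dim (tangent X x) = pdim X + 1)"

definition prime_divisor :: "(complex^'n) set \<Rightarrow> (complex^'n) set \<Rightarrow> bool" where
  "prime_divisor X Z \<longleftrightarrow>
     projective_variety Z \<and> Z \<subset> X \<and> \<not> (\<exists>W. projective_variety W \<and> Z \<subset> W \<and> W \<subset> X)"


section \<open>Divisors and linear equivalence\<close>

inductive ideal_power :: "(complex^'n \<Rightarrow> complex) set \<Rightarrow> nat \<Rightarrow> (complex^'n \<Rightarrow> complex) \<Rightarrow> bool"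
  for I :: "(complex^'n \<Rightarrow> complex) set" where
  zeroth: "f \<in> polys \<Longrightarrow> ideal_power I 0 f"
| null: "ideal_power I m (\<lambda>_. 0)"
| step: "f \<in> I \<Longrightarrow> ideal_power I m g \<Longrightarrow> ideal_power I (Suc m) (\<lambda>x. f x * g x)"
| add: "ideal_power I m f \<Longrightarrow> ideal_power I m g \<Longrightarrow> ideal_power I m (\<lambda>x. f x + g x)"

text \<open>
  The order of vanishing of \<open>F\<close> along the prime divisor \<open>Z\<close>: the largest \<open>m\<close> such that \<open>F\<close> lies
  in the \<open>m\<close>-th power of the maximal ideal of the local ring of the cone of \<open>X\<close> along that of
  \<open>Z\<close> (\<open>h\<close> is a denominator, and equality holds modulo the ideal of \<open>X\<close>). For smooth \<open>X\<close> this
  local ring is a discrete valuation ring. Only meaningful if \<open>F\<close> does not vanish on \<open>X\<close>.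
\<close>

definition vanishing_order ::
  "(complex^'n) set \<Rightarrow> (complex^'n) set \<Rightarrow> (complex^'n \<Rightarrow> complex) \<Rightarrow> nat" where
  "vanishing_order X Z F =
     Sup {m. \<exists>h f. h \<in> polys \<and> h \<notin> vanishing_ideal Z \<and> ideal_power (vanishing_ideal Z) m f \<and>
                   (\<forall>x\<in>X. h x * F x = f x)}"

text \<open>Divisors are elements of the free abelian group \<open>(complex^'n) set \<Rightarrow>\<^sub>0 int\<close>.\<close>

definition lin_equiv ::
  "(complex^'n) set \<Rightarrow> ((complex^'n) set \<Rightarrow>\<^sub>0 int) \<Rightarrow> ((complex^'n) set \<Rightarrow>\<^sub>0 int) \<Rightarrow> bool" where
  "lin_equiv X D E \<longleftrightarrow>
     (\<exists>d F G. form d F \<and> form d G \<and> F \<notin> vanishing_ideal X \<and> G \<notin> vanishing_ideal X \<and>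
        (\<forall>Z. prime_divisor X Z \<longrightarrow>
           Poly_Mapping.lookup D Z - Poly_Mapping.lookup E Z =
             int (vanishing_order X Z F) - int (vanishing_order X Z G)))"


section \<open>The group K and its root data\<close>

type_synonym mat_pair = "complex mat \<times> complex mat"

definition SGL :: "nat \<Rightarrow> nat \<Rightarrow> mat_pair monoid" where
  "SGL p q =
     \<lparr>carrier = {(g, h). g \<in> carrier_mat p p \<and> h \<in> carrier_mat q q \<and>
                         Determinant.det g * Determinant.det h = 1},
      monoid.mult = (\<lambda>(g, h) (g', h'). (g * g', h * h')),
      one = (1\<^sub>m p, 1\<^sub>m q)\<rparr>"

definition borel_subgroup :: "nat \<Rightarrow> nat \<Rightarrow> mat_pair set" where
  "borel_subgroup p q = {(g, h) \<in> carrier (SGL p q). upper_triangular g \<and> upper_triangular h}"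

definition opposite_borel :: "nat \<Rightarrow> nat \<Rightarrow> mat_pair set" where
  "opposite_borel p q =
     {(g, h) \<in> carrier (SGL p q). upper_triangular (transpose_mat g) \<and> upper_triangular (transpose_mat h)}"

definition torus :: "nat \<Rightarrow> nat \<Rightarrow> mat_pair set" where
  "torus p q = {(g, h) \<in> carrier (SGL p q). diagonal_mat g \<and> diagonal_mat h}"

text \<open>\<open>Alpha i\<close> is the simple root \<open>\<alpha>\<^sub>i\<close> of \<open>GL(p)\<close>, \<open>Alpha' i\<close> the simple root \<open>\<alpha>'\<^sub>i\<close> of \<open>GL(q)\<close>
  (numbered from 1, whereas matrix entries are numbered from 0).\<close>

datatype simple_root = Alpha nat | Alpha' nat

definition simple_roots :: "nat \<Rightarrow> nat \<Rightarrow> simple_root set" where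
  "simple_roots p q = Alpha ` {1..<p} \<union> Alpha' ` {1..<q}"

text \<open>Characters of the torus are written multiplicatively, as functions that are \<open>undefined\<close>
  outside the torus.\<close>

fun root_char :: "nat \<Rightarrow> nat \<Rightarrow> simple_root \<Rightarrow> (mat_pair \<Rightarrow> complex)" where
  "root_char p q (Alpha i) = (\<lambda>t\<in>torus p q. fst t $$ (i - 1, i - 1) / fst t $$ (i, i))"
| "root_char p q (Alpha' i) = (\<lambda>t\<in>torus p q. snd t $$ (i - 1, i - 1) / snd t $$ (i, i))"

fun minimal_parabolic :: "nat \<Rightarrow> nat \<Rightarrow> simple_root \<Rightarrow> mat_pair set" where
  "minimal_parabolic p q (Alpha i) =
     {(g, h) \<in> carrier (SGL p q).
        (\<forall>a<p. \<forall>b<a. (a, b) \<noteq> (i, i - 1) \<longrightarrow> g $$ (a, b) = 0) \<and> upper_triangular h}"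
| "minimal_parabolic p q (Alpha' i) =
     {(g, h) \<in> carrier (SGL p q).
        upper_triangular g \<and> (\<forall>a<q. \<forall>b<a. (a, b) \<noteq> (i, i - 1) \<longrightarrow> h $$ (a, b) = 0)}"

text \<open>The isotropy representation: an element of \<open>\<pp> = \<pp>\<^sub>1 \<oplus> \<pp>\<^sub>2\<close> is a pair of a \<open>p \<times> q\<close> matrix and a
  \<open>q \<times> p\<close> matrix.\<close>

definition isotropy_act :: "nat \<Rightarrow> nat \<Rightarrow> mat_pair \<Rightarrow> mat_pair \<Rightarrow> mat_pair" where
  "isotropy_act p q k x =
     (fst k * fst x * snd (inv\<^bsub>SGL p q\<^esub> k), snd k * snd x * fst (inv\<^bsub>SGL p q\<^esub> k))"

text \<open>The representative of the nilpotent orbit with signed partition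
  \<open>(+3, +2\<^sup>r, -2\<^sup>s, +1\<^sup>p\<^sup>-\<^sup>r\<^sup>-\<^sup>s\<^sup>-\<^sup>2, -1\<^sup>q\<^sup>-\<^sup>r\<^sup>-\<^sup>s\<^sup>-\<^sup>1)\<close>. The summand
  \<open>e\<^sub>a \<otimes> \<phi>'\<^sub>b\<close> is the matrix unit in position \<open>(a, b)\<close>, counted from 1; the summand
  \<open>e\<^sub>1 \<otimes> \<phi>'\<^sub>q\<^sub>-\<^sub>r\<close> is the case \<open>i = 0\<close>.\<close>

definition nilpotent_rep :: "nat \<Rightarrow> nat \<Rightarrow> nat \<Rightarrow> nat \<Rightarrow> mat_pair" where
  "nilpotent_rep p q r s =
     (Matrix.mat p q (\<lambda>(a, b). if \<exists>i\<in>{0..r}. (a + 1, b + 1) = (i + 1, q - r + i) then 1 else 0),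
      Matrix.mat q p (\<lambda>(a, b). if (\<exists>i\<in>{1..s}. (a + 1, b + 1) = (i, p - s + i - 1)) \<or>
                                   (a + 1, b + 1) = (q - r, p) then 1 else 0))"


section \<open>Wonderful varieties for K\<close>

text \<open>A projective \<open>K\<close>-variety is a \<open>K\<close>-stable subvariety of the projective space of a rational
  representation \<open>\<rho>\<close>. On \<open>K\<close> the inverses of the determinants are polynomials in the entries.\<close>

definition rational_rep :: "nat \<Rightarrow> nat \<Rightarrow> (mat_pair \<Rightarrow> complex^'n^'n) \<Rightarrow> bool" where
  "rational_rep p q \<rho> \<longleftrightarrow>
     \<rho> \<one>\<^bsub>SGL p q\<^esub> = Finite_Cartesian_Product.mat 1 \<and>
     (\<forall>g\<in>carrier (SGL p q). \<forall>h\<in>carrier (SGL p q). \<rho> (g \<otimes>\<^bsub>SGL p q\<^esub> h) = \<rho> g ** \<rho> h) \<and>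
     (\<forall>i j. \<exists>f \<in> poly_funs ({\<lambda>k. fst k $$ (a, b) | a b. a < p \<and> b < p} \<union>
                            {\<lambda>k. snd k $$ (a, b) | a b. a < q \<and> b < q}).
        \<forall>k\<in>carrier (SGL p q). \<rho> k $ i $ j = f k)"

definition translate ::
  "(mat_pair \<Rightarrow> complex^'n^'n) \<Rightarrow> mat_pair set \<Rightarrow> (complex^'n) set \<Rightarrow> (complex^'n) set" where
  "translate \<rho> H Z = {\<rho> k *v x | k x. k \<in> H \<and> x \<in> Z}"

definition line_orbit ::
  "nat \<Rightarrow> nat \<Rightarrow> (mat_pair \<Rightarrow> complex^'n^'n) \<Rightarrow> complex^'n \<Rightarrow> (complex^'n) set" where
  "line_orbit p q \<rho> x = {c *s (\<rho> k *v x) | c k. k \<in> carrier (SGL p q)}"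

definition line_stabilizer ::
  "nat \<Rightarrow> nat \<Rightarrow> (mat_pair \<Rightarrow> complex^'n^'n) \<Rightarrow> complex^'n \<Rightarrow> mat_pair set" where
  "line_stabilizer p q \<rho> x = {k \<in> carrier (SGL p q). \<exists>c. \<rho> k *v x = c *s x}"

definition in_open_orbit ::
  "nat \<Rightarrow> nat \<Rightarrow> (mat_pair \<Rightarrow> complex^'n^'n) \<Rightarrow> (complex^'n) set \<Rightarrow> complex^'n \<Rightarrow> bool" where
  "in_open_orbit p q \<rho> X x \<longleftrightarrow> x \<in> X - {0} \<and> zclosed (insert 0 (X - line_orbit p q \<rho> x))"

text \<open>Smooth divisors cross normally iff at each point the tangent spaces of those
  passing through it intersect transversally.\<close>

definition normal_crossings :: "(complex^'n) set \<Rightarrow> (complex^'n) set set \<Rightarrow> bool" where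
  "normal_crossings X \<D> \<longleftrightarrow>
     (\<forall>x\<in>X - {0}. vec.dim (tangent X x \<inter> (\<Inter>D\<in>{D\<in>\<D>. x \<in> D}. tangent D x)) + card {D\<in>\<D>. x \<in> D}
                  = vec.dim (tangent X x))"

definition wonderful_variety ::
  "nat \<Rightarrow> nat \<Rightarrow> (mat_pair \<Rightarrow> complex^'n^'n) \<Rightarrow> (complex^'n) set \<Rightarrow> bool" where
  "wonderful_variety p q \<rho> X \<longleftrightarrow>
     rational_rep p q \<rho> \<and> smooth_variety X \<and> translate \<rho> (carrier (SGL p q)) X \<subseteq> X \<and>
     (\<exists>x \<D>. in_open_orbit p q \<rho> X x \<and>
        finite \<D> \<and> (\<forall>D\<in>\<D>. prime_divisor X D \<and> smooth_variety D) \<and>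
        insert 0 (X - line_orbit p q \<rho> x) = insert 0 (\<Union>\<D>) \<and>
        normal_crossings X \<D> \<and> \<not> X \<inter> \<Inter>\<D> \<subseteq> {0} \<and>
        (\<forall>y\<in>X - {0}. \<forall>z\<in>X - {0}.
           line_orbit p q \<rho> y = line_orbit p q \<rho> z \<longleftrightarrow> {D\<in>\<D>. y \<in> D} = {D\<in>\<D>. z \<in> D}))"

text \<open>\<open>x\<^sub>0\<close> is the point of the open orbit corresponding to the base point of \<open>K/H\<close>.\<close>

definition wonderful_compactification ::
  "nat \<Rightarrow> nat \<Rightarrow> (mat_pair \<Rightarrow> complex^'n^'n) \<Rightarrow> (complex^'n) set \<Rightarrow> complex^'n \<Rightarrow> mat_pair set \<Rightarrow> bool"
  where
  "wonderful_compactification p q \<rho> X x\<^sub>0 H \<longleftrightarrow>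
     wonderful_variety p q \<rho> X \<and> in_open_orbit p q \<rho> X x\<^sub>0 \<and> line_stabilizer p q \<rho> x\<^sub>0 = H"

definition colors ::
  "nat \<Rightarrow> nat \<Rightarrow> (mat_pair \<Rightarrow> complex^'n^'n) \<Rightarrow> (complex^'n) set \<Rightarrow> (complex^'n) set set" where
  "colors p q \<rho> X =
     {D. prime_divisor X D \<and> translate \<rho> (borel_subgroup p q) D = D \<and>
         translate \<rho> (carrier (SGL p q)) D \<noteq> D}"

definition stable_prime_divisors ::
  "nat \<Rightarrow> nat \<Rightarrow> (mat_pair \<Rightarrow> complex^'n^'n) \<Rightarrow> (complex^'n) set \<Rightarrow> (complex^'n) set set" where
  "stable_prime_divisors p q \<rho> X =
     {D. prime_divisor X D \<and> translate \<rho> (carrier (SGL p q)) D = D}"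

definition moves ::
  "nat \<Rightarrow> nat \<Rightarrow> (mat_pair \<Rightarrow> complex^'n^'n) \<Rightarrow> simple_root \<Rightarrow> (complex^'n) set \<Rightarrow> bool" where
  "moves p q \<rho> \<alpha> D \<longleftrightarrow> translate \<rho> (minimal_parabolic p q \<alpha>) D \<noteq> D"

text \<open>
  \<open>W\<close> and \<open>U\<close> are the tangent spaces at \<open>y\<close> of cones whose projectivizations have tangent spaces
  \<open>W'\<close> and \<open>U'\<close> at the \<open>T\<close>-fixed point \<open>[y]\<close>. As the tangent space of a projective space at a
  line \<open>l \<subseteq> V\<close> is \<open>Hom(l, V/l)\<close>, the quotient \<open>W/U\<close> is \<open>W'/U'\<close> twisted by the character \<open>c\<close>
  by which \<open>T\<close> acts on the line of \<open>y\<close>.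
\<close>

definition normal_weight ::
  "nat \<Rightarrow> nat \<Rightarrow> (mat_pair \<Rightarrow> complex^'n^'n) \<Rightarrow> complex^'n \<Rightarrow> (complex^'n) set \<Rightarrow> (complex^'n) set \<Rightarrow>
   (mat_pair \<Rightarrow> complex) \<Rightarrow> bool" where
  "normal_weight p q \<rho> y W U \<gamma> \<longleftrightarrow>
     \<gamma> \<in> extensional (torus p q) \<and>
     (\<exists>v\<in>W - U. \<forall>t\<in>torus p q. \<forall>c. \<rho> t *v y = c *s y \<longrightarrow> \<rho> t *v v - (\<gamma> t * c) *s v \<in> U)"

text \<open>\<open>[y]\<close> is the point of the closed orbit fixed by the opposite Borel subgroup.\<close>

definition closed_orbit_point ::
  "nat \<Rightarrow> nat \<Rightarrow> (mat_pair \<Rightarrow> complex^'n^'n) \<Rightarrow> (complex^'n) set \<Rightarrow> complex^'n \<Rightarrow> bool" where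
  "closed_orbit_point p q \<rho> X y \<longleftrightarrow>
     y \<in> X - {0} \<and> zclosed (line_orbit p q \<rho> y) \<and> opposite_borel p q \<subseteq> line_stabilizer p q \<rho> y"

definition spherical_roots ::
  "nat \<Rightarrow> nat \<Rightarrow> (mat_pair \<Rightarrow> complex^'n^'n) \<Rightarrow> (complex^'n) set \<Rightarrow> (mat_pair \<Rightarrow> complex) set" where
  "spherical_roots p q \<rho> X =
     {\<gamma>. \<exists>y. closed_orbit_point p q \<rho> X y \<and>
             normal_weight p q \<rho> y (tangent X y) (tangent (line_orbit p q \<rho> y) y) \<gamma>}"

text \<open>The \<open>K\<close>-stable prime divisor of a spherical root: the one on whose normal line at \<open>[y]\<close>
  the torus acts by that root.\<close>

definition root_divisor ::
  "nat \<Rightarrow> nat \<Rightarrow> (mat_pair \<Rightarrow> complex^'n^'n) \<Rightarrow> (complex^'n) set \<Rightarrow> (mat_pair \<Rightarrow> complex) \<Rightarrow>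
   (complex^'n) set" where
  "root_divisor p q \<rho> X \<gamma> =
     (THE D. D \<in> stable_prime_divisors p q \<rho> X \<and>
        (\<exists>y. closed_orbit_point p q \<rho> X y \<and> normal_weight p q \<rho> y (tangent X y) (tangent D y) \<gamma>))"

text \<open>The image of a spherical root in \<open>Pic(X) = \<int>\<Delta>\<close>.\<close>

definition root_class ::
  "nat \<Rightarrow> nat \<Rightarrow> (mat_pair \<Rightarrow> complex^'n^'n) \<Rightarrow> (complex^'n) set \<Rightarrow> (mat_pair \<Rightarrow> complex) \<Rightarrow>
   ((complex^'n) set \<Rightarrow>\<^sub>0 int)" where
  "root_class p q \<rho> X \<gamma> =
     (THE E. Poly_Mapping.keys E \<subseteq> colors p q \<rho> X \<and>
             lin_equiv X E (frag_of (root_divisor p q \<rho> X \<gamma>)))"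

definition effective_colors ::
  "nat \<Rightarrow> nat \<Rightarrow> (mat_pair \<Rightarrow> complex^'n^'n) \<Rightarrow> (complex^'n) set \<Rightarrow> ((complex^'n) set \<Rightarrow>\<^sub>0 int) set" where
  "effective_colors p q \<rho> X =
     {E. Poly_Mapping.keys E \<subseteq> colors p q \<rho> X \<and> (\<forall>D. Poly_Mapping.lookup E D \<ge> 0)}"

text \<open>The semigroup generated by \<open>A\<close>, which contains 0 (it generalizes \<open>\<nat>A\<close>).\<close>

inductive_set semigroup_gen :: "'a::comm_monoid_add set \<Rightarrow> 'a set" for A :: "'a set" where
  zero: "0 \<in> semigroup_gen A"
| add: "a \<in> A \<Longrightarrow> x \<in> semigroup_gen A \<Longrightarrow> a + x \<in> semigroup_gen A"

definition le_Sigma ::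
  "nat \<Rightarrow> nat \<Rightarrow> (mat_pair \<Rightarrow> complex^'n^'n) \<Rightarrow> (complex^'n) set \<Rightarrow>
   ((complex^'n) set \<Rightarrow>\<^sub>0 int) \<Rightarrow> ((complex^'n) set \<Rightarrow>\<^sub>0 int) \<Rightarrow> bool" where
  "le_Sigma p q \<rho> X D E \<longleftrightarrow> E - D \<in> semigroup_gen (root_class p q \<rho> X ` spherical_roots p q \<rho> X)"


section \<open>The divisors of the projections of the orbit\<close>

text \<open>
  \<open>F\<close>, a matrix of forms of the same degree, represents (where it does not vanish) the rational
  map from \<open>X\<close> to the projective space of the \<open>m \<times> l\<close> matrices that sends \<open>[k x\<^sub>0]\<close> to \<open>[\<phi> k]\<close>.
\<close>

definition represents ::
  "nat \<Rightarrow> nat \<Rightarrow> (mat_pair \<Rightarrow> complex^'n^'n) \<Rightarrow> complex^'n \<Rightarrow> nat \<Rightarrow> nat \<Rightarrow> (mat_pair \<Rightarrow> complex mat) \<Rightarrow>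
   (complex^'n \<Rightarrow> complex mat) \<Rightarrow> bool" where
  "represents p q \<rho> x\<^sub>0 m l \<phi> F \<longleftrightarrow>
     (\<forall>x. F x \<in> carrier_mat m l) \<and> (\<exists>d. \<forall>a<m. \<forall>b<l. form d (\<lambda>x. F x $$ (a, b))) \<and>
     (\<forall>k\<in>carrier (SGL p q). \<exists>c. F (\<rho> k *v x\<^sub>0) = c \<cdot>\<^sub>m \<phi> k)"

text \<open>
  The rational map given by \<open>\<phi>\<close> extends to a morphism on \<open>X\<close>, and the pullback of
  \<open>\<O>(1)\<close> is the line bundle of \<open>E\<close>. Here \<open>H\<close> is the pullback of the
  hyperplane where the entry \<open>(a, b)\<close> is zero; its multiplicity along \<open>Z\<close> is computed by
  any \<open>F\<close> that represents the morphism at the generic point of \<open>Z\<close>.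
\<close>

definition is_pullback_O1 ::
  "nat \<Rightarrow> nat \<Rightarrow> (mat_pair \<Rightarrow> complex^'n^'n) \<Rightarrow> (complex^'n) set \<Rightarrow> complex^'n \<Rightarrow> nat \<Rightarrow> nat \<Rightarrow>
   (mat_pair \<Rightarrow> complex mat) \<Rightarrow> ((complex^'n) set \<Rightarrow>\<^sub>0 int) \<Rightarrow> bool" where
  "is_pullback_O1 p q \<rho> X x\<^sub>0 m l \<phi> E \<longleftrightarrow>
     (\<forall>x\<in>X - {0}. \<exists>F. represents p q \<rho> x\<^sub>0 m l \<phi> F \<and> F x \<noteq> 0\<^sub>m m l) \<and>
     (\<exists>a<m. \<exists>b<l. \<exists>H.
        (\<exists>F. represents p q \<rho> x\<^sub>0 m l \<phi> F \<and> (\<lambda>x. F x $$ (a, b)) \<notin> vanishing_ideal X) \<and>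
        Poly_Mapping.keys H \<subseteq> {Z. prime_divisor X Z} \<and>
        (\<forall>Z F. prime_divisor X Z \<and> represents p q \<rho> x\<^sub>0 m l \<phi> F \<and> (\<exists>x\<in>Z. F x \<noteq> 0\<^sub>m m l) \<longrightarrow>
           Poly_Mapping.lookup H Z = int (vanishing_order X Z (\<lambda>x. F x $$ (a, b)))) \<and>
        lin_equiv X E H)"

definition D_p1 ::
  "nat \<Rightarrow> nat \<Rightarrow> (mat_pair \<Rightarrow> complex^'n^'n) \<Rightarrow> (complex^'n) set \<Rightarrow> complex^'n \<Rightarrow> mat_pair \<Rightarrow>
   ((complex^'n) set \<Rightarrow>\<^sub>0 int)" where
  "D_p1 p q \<rho> X x\<^sub>0 e =
     (THE E. E \<in> effective_colors p q \<rho> X \<and>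
             is_pullback_O1 p q \<rho> X x\<^sub>0 p q (\<lambda>k. fst (isotropy_act p q k e)) E)"

definition D_p2 ::
  "nat \<Rightarrow> nat \<Rightarrow> (mat_pair \<Rightarrow> complex^'n^'n) \<Rightarrow> (complex^'n) set \<Rightarrow> complex^'n \<Rightarrow> mat_pair \<Rightarrow>
   ((complex^'n) set \<Rightarrow>\<^sub>0 int)" where
  "D_p2 p q \<rho> X x\<^sub>0 e =
     (THE E. E \<in> effective_colors p q \<rho> X \<and>
             is_pullback_O1 p q \<rho> X x\<^sub>0 q p (\<lambda>k. snd (isotropy_act p q k e)) E)"

definition Gamma_p ::
  "nat \<Rightarrow> nat \<Rightarrow> (mat_pair \<Rightarrow> complex^'n^'n) \<Rightarrow> (complex^'n) set \<Rightarrow> complex^'n \<Rightarrow> mat_pair \<Rightarrow>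
   (nat \<times> nat \<times> ((complex^'n) set \<Rightarrow>\<^sub>0 int)) set" where
  "Gamma_p p q \<rho> X x\<^sub>0 e =
     {(n\<^sub>1, n\<^sub>2, E). E \<in> effective_colors p q \<rho> X \<and>
        le_Sigma p q \<rho> X E
          (frag_cmul (int n\<^sub>1) (D_p1 p q \<rho> X x\<^sub>0 e) + frag_cmul (int n\<^sub>2) (D_p2 p q \<rho> X x\<^sub>0 e))}"


section \<open>Notation for the spherical system\<close>

definition sigma1 :: "nat \<Rightarrow> nat \<Rightarrow> simple_root" where
  "sigma1 p h = (if odd h then Alpha (p - (h + 1) div 2) else Alpha' (h div 2))"

definition sigma2 :: "nat \<Rightarrow> nat \<Rightarrow> simple_root" where
  "sigma2 q h = (if odd h then Alpha ((h + 1) div 2) else Alpha' (q - h div 2))"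

definition tau_char :: "nat \<Rightarrow> nat \<Rightarrow> nat \<Rightarrow> nat \<Rightarrow> (mat_pair \<Rightarrow> complex)" where
  "tau_char p q r s = (\<lambda>t\<in>torus p q. \<Prod>i\<in>{r + 1..q - s - 1}. root_char p q (Alpha' i) t)"

definition moved_only_by ::
  "nat \<Rightarrow> nat \<Rightarrow> (mat_pair \<Rightarrow> complex^'n^'n) \<Rightarrow> simple_root \<Rightarrow> (complex^'n) set \<Rightarrow> bool" where
  "moved_only_by p q \<rho> \<alpha> D \<longleftrightarrow> (\<forall>\<beta>\<in>simple_roots p q. moves p q \<rho> \<beta> D \<longleftrightarrow> \<beta> = \<alpha>)"

text \<open>\<open>D 1, \<dots>, D (2N+2)\<close> are the colors attached to the chain of spherical roots
  \<open>\<sigma> 1, \<dots>, \<sigma> (2N)\<close> followed by the simple root \<open>\<beta>\<close>.\<close>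

definition color_chain ::
  "nat \<Rightarrow> nat \<Rightarrow> (mat_pair \<Rightarrow> complex^'n^'n) \<Rightarrow> (complex^'n) set \<Rightarrow> nat \<Rightarrow> (nat \<Rightarrow> simple_root) \<Rightarrow>
   simple_root \<Rightarrow> (nat \<Rightarrow> (complex^'n) set) \<Rightarrow> bool" where
  "color_chain p q \<rho> X N \<sigma> \<beta> D \<longleftrightarrow>
     {C \<in> colors p q \<rho> X. moved_only_by p q \<rho> (\<sigma> 1) C} = {D 1} \<and>
     (\<forall>h\<in>{2..2*N}. {C \<in> colors p q \<rho> X. moves p q \<rho> (\<sigma> (h - 1)) C \<and> moves p q \<rho> (\<sigma> h) C} = {D h}) \<and>
     {C \<in> colors p q \<rho> X. moved_only_by p q \<rho> (\<sigma> (2*N)) C} = {D (2*N + 1)} \<and>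
     {C \<in> colors p q \<rho> X. moves p q \<rho> \<beta> C} = {D (2*N + 2)}"

text \<open>\<open>tilde N D h\<close> is used for \<open>h \<le> 2N+2\<close> only.\<close>

definition tilde :: "nat \<Rightarrow> (nat \<Rightarrow> 'a) \<Rightarrow> nat \<Rightarrow> ('a \<Rightarrow>\<^sub>0 int)" where
  "tilde N D h =
     (if h = 0 then 0
      else if h < 2*N + 1 then frag_of (D h)
      else frag_of (D h) + frag_of (D (h + 1)))"

end

theory Submission
  imports Defs
begin

text \<open>Write \<open>T\<^sub>h\<close>, \<open>T'\<^sub>h\<close> for the divisors \<open>tilde r D1 h\<close>, \<open>tilde s D2 h\<close>. Since
  \<open>\<tau> = (T\<^sub>2\<^sub>r\<^sub>+\<^sub>2 - T\<^sub>2\<^sub>r\<^sub>+\<^sub>1) + (T'\<^sub>2\<^sub>s\<^sub>+\<^sub>2 - T'\<^sub>2\<^sub>s\<^sub>+\<^sub>1)\<close>, all spherical roots are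
  combinations of these divisors, so any \<open>E = n\<^sub>1 T\<^sub>2 + n\<^sub>2 T'\<^sub>2 - \<Sum> a\<^sub>\<sigma> \<sigma>\<close> is of the form
  \<open>\<Sum> x\<^sub>k T\<^sub>k + \<Sum> y\<^sub>k T'\<^sub>k\<close>. Each \<open>x\<^sub>k\<close> is the coefficient of \<open>E\<close> in a color that occurs in no other
  \<open>T\<^sub>h\<close> and in no \<open>T'\<^sub>h\<close>, whence \<open>x\<^sub>k \<ge> 0\<close> if \<open>E\<close> is effective. The \<open>x\<^sub>k\<close> with \<open>k\<close> odd and the
  \<open>y\<^sub>k\<close> with \<open>k\<close> odd both sum to the coefficient of \<open>\<tau>\<close>, so that the odd terms of the two chains can be paired off, and this
  writes \<open>E\<close> as a sum of generators.\<close>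

text \<open>Defined over any abelian group, so that it applies to divisors, to their coefficients in
  one color and to integer weights alike. For \<open>h = 1\<close> it involves \<open>T 0\<close>,
  which is 0 in every use.\<close>

definition chain_root :: "(nat \<Rightarrow> 'a::ab_group_add) \<Rightarrow> nat \<Rightarrow> 'a" where
  "chain_root T h = - T (h - 1) + T h + T (h + 1) - T (h + 2)"

section \<open>Semigroups generated by a set\<close>

lemma semigroup_gen_incl: "a \<in> A \<Longrightarrow> a \<in> semigroup_gen A"
  using semigroup_gen.add[of a A 0] by (simp add: semigroup_gen.zero)

lemma semigroup_gen_plus:
  assumes "x \<in> semigroup_gen A" "y \<in> semigroup_gen A"
  shows "x + y \<in> semigroup_gen A"
  using assms by induction (auto simp: add.assoc intro: semigroup_gen.add)

lemma semigroup_gen_sum: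
  "(\<And>i. i \<in> I \<Longrightarrow> f i \<in> semigroup_gen A) \<Longrightarrow> sum f I \<in> semigroup_gen A"
  by (induction I rule: infinite_finite_induct)
    (auto intro: semigroup_gen.zero semigroup_gen_plus)

lemma semigroup_gen_least:
  assumes "A \<subseteq> M" "0 \<in> M" "\<And>x y. x \<in> M \<Longrightarrow> y \<in> M \<Longrightarrow> x + y \<in> M"
  shows "semigroup_gen A \<subseteq> M"
proof
  show "x \<in> M" if "x \<in> semigroup_gen A" for x
    using that by induction (use assms in auto)
qed

section \<open>Linear combinations along a single chain\<close>

text \<open>The point is that \<open>x\<close> is chosen before \<open>T\<close>: one family of
  coefficients serves every integer sequence, hence the coefficients in all colors at once as well
  as numerical weights.\<close>

lemma chain_root_combination:
  fixes n c :: int and a :: "nat \<Rightarrow> int"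
  obtains x :: "nat \<Rightarrow> int" where
    "\<And>T :: nat \<Rightarrow> int. T 0 = 0 \<Longrightarrow>
       (\<Sum>k=1..N + 2. x k * T k) =
       n * T 2 - (\<Sum>h=1..N. a h * chain_root T h) - c * (T (N + 2) - T (N + 1))"
proof
  define K where "K = {1..N + 2}"
  define ind :: "nat \<Rightarrow> nat \<Rightarrow> int" where "ind k l = (if k = l then 1 else 0)" for k l
  \<comment> \<open>The right-hand side is linear in \<open>T\<close>, so the coefficient of
    \<open>T k\<close> is its value at the indicator sequence of \<open>k\<close>.\<close>
  define x where "x k = n * ind k 2 - (\<Sum>h=1..N. a h * chain_root (ind k) h)
    - c * (ind k (N + 2) - ind k (N + 1))" for k
  fix T :: "nat \<Rightarrow> int"
  assume T0: "T 0 = 0"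
  \<comment> \<open>The index 0 lies outside \<open>K\<close>, yet it occurs in the first root;
    there both sides are 0 because \<open>T 0 = 0\<close>.\<close>
  have ind: "(\<Sum>k\<in>K. ind k l * T k) = T l" if "l \<le> N + 2" for l
    using that T0
    by (cases "l = 0") (auto simp: K_def ind_def if_distrib[of "\<lambda>u. u * _"] cong: if_cong)
  have root: "(\<Sum>k\<in>K. chain_root (ind k) h * T k) = chain_root T h" if "h \<in> {1..N}" for h
  proof -
    have "h - 1 \<le> N + 2" using that by auto
    with that show ?thesis
      by (simp add: chain_root_def ring_distribs sum.distrib sum_subtractf sum_negf ind)
  qed
  have "(\<Sum>k\<in>K. x k * T k) =
      n * (\<Sum>k\<in>K. ind k 2 * T k)
      - (\<Sum>k\<in>K. \<Sum>h=1..N. a h * (chain_root (ind k) h * T k))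
      - c * ((\<Sum>k\<in>K. ind k (N + 2) * T k) - (\<Sum>k\<in>K. ind k (N + 1) * T k))"
    by (simp add: x_def ring_distribs sum.distrib sum_subtractf sum_distrib_left sum_distrib_right
          mult.assoc)
  also have "(\<Sum>k\<in>K. \<Sum>h=1..N. a h * (chain_root (ind k) h * T k)) =
      (\<Sum>h=1..N. a h * (\<Sum>k\<in>K. chain_root (ind k) h * T k))"
    by (subst sum.swap) (simp add: sum_distrib_left)
  also have "\<dots> = (\<Sum>h=1..N. a h * chain_root T h)"
    using root by simp
  finally have "(\<Sum>k\<in>K. x k * T k) =
      n * T 2 - (\<Sum>h=1..N. a h * chain_root T h) - c * (T (N + 2) - T (N + 1))"
    by (simp add: ind)
  then show "(\<Sum>k=1..N + 2. x k * T k) =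
      n * T 2 - (\<Sum>h=1..N. a h * chain_root T h) - c * (T (N + 2) - T (N + 1))"
    unfolding K_def .
qed

text \<open>Each \<open>T 2 + T (2 * i) - T (2 * i + 2)\<close> is a sum of roots: passing to the
  next \<open>i\<close> adds the roots with indices \<open>2 * i + 1\<close> and
  \<open>2 * i + 2\<close>. Adding up these differences telescopes.\<close>

lemma chain_even_le:
  fixes T :: "nat \<Rightarrow> 'a::ab_group_add"
  assumes S: "\<And>h. h \<in> {1..2 * r} \<Longrightarrow> chain_root T h \<in> S" and T0: "T 0 = 0" and "i \<le> r + 1"
  shows "(\<Sum>_<i. T 2) - T (2 * i) \<in> semigroup_gen S"
proof -
  have step: "T 2 + T (2 * i) - T (2 * i + 2) \<in> semigroup_gen S" if "i \<le> r" for i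
    using that
  proof (induction i)
    case 0
    then show ?case by (simp add: T0 semigroup_gen.zero numeral_2_eq_2)
  next
    case (Suc i)
    have "chain_root T (2 * i + 1) + (chain_root T (2 * i + 2) +
        (T 2 + T (2 * i) - T (2 * i + 2))) \<in> semigroup_gen S"
      using Suc by (intro semigroup_gen.add S) auto
    then show ?case by (simp add: chain_root_def algebra_simps eval_nat_numeral)
  qed
  show ?thesis
    using \<open>i \<le> r + 1\<close>
  proof (induction i)
    case 0
    then show ?case by (simp add: T0 semigroup_gen.zero)
  next
    case (Suc i)
    then have "((\<Sum>_<i. T 2) - T (2 * i)) + (T 2 + T (2 * i) - T (2 * i + 2)) \<in> semigroup_gen S"
      by (intro semigroup_gen_plus step) auto
    then show ?case by (simp add: algebra_simps)
  qed
qed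

text \<open>An even-indexed root \<open>chain_root T (2 * i)\<close> is the difference of
  \<open>T (2 * i) - T (2 * i - 1)\<close> and its successor, so these roots telescope down from
  \<open>r + 1\<close>. The difference that remains at the end is the share of this chain in
  \<tau>.\<close>

lemma chain_odd_le:
  fixes T :: "nat \<Rightarrow> 'a::ab_group_add"
  assumes S: "\<And>h. h \<in> {1..2 * r} \<Longrightarrow> chain_root T h \<in> S" and T0: "T 0 = 0"
    and "1 \<le> i" "i \<le> r + 1"
  shows "(\<Sum>_<i. T 2) - T (2 * i - 1) - (T (2 * r + 2) - T (2 * r + 1)) \<in> semigroup_gen S"
proof -
  have "T (2 * i) - T (2 * i - 1) - (T (2 * r + 2) - T (2 * r + 1)) \<in> semigroup_gen S"
    using \<open>i \<le> r + 1\<close> \<open>1 \<le> i\<close>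
  proof (induction i rule: inc_induct)
    case base
    then show ?case by (simp add: semigroup_gen.zero)
  next
    case (step i)
    have "chain_root T (2 * i) + (T (2 * Suc i) - T (2 * Suc i - 1)
        - (T (2 * r + 2) - T (2 * r + 1))) \<in> semigroup_gen S"
      using step by (intro semigroup_gen.add S) auto
    then show ?case by (simp add: chain_root_def algebra_simps)
  qed
  from semigroup_gen_plus[OF chain_even_le[where i = i, OF S T0 \<open>i \<le> r + 1\<close>] this] show ?thesis
    by (simp add: algebra_simps)
qed

text \<open>The terms \<open>f i\<close> and \<open>g j\<close>, listed with multiplicity, are
  equally many, so a bijection between the two lists groups them into pairs, each of which is an
  element of \<open>A\<close>.\<close>

lemma semigroup_gen_balanced_sum:
  fixes x y :: "nat \<Rightarrow> nat"
  assumes "finite I" "finite J" and card: "sum x I = sum y J"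
    and A: "\<And>i j. i \<in> I \<Longrightarrow> j \<in> J \<Longrightarrow> f i + g j \<in> A"
  shows "(\<Sum>i\<in>I. \<Sum>_<x i. f i) + (\<Sum>j\<in>J. \<Sum>_<y j. g j) \<in> semigroup_gen A"
proof -
  let ?U = "SIGMA i:I. {..<x i}" and ?V = "SIGMA j:J. {..<y j}"
  have "card ?U = card ?V"
    using assms by (simp add: card_SigmaI)
  then obtain b where b: "bij_betw b ?U ?V"
    using assms finite_same_card_bij[of ?U ?V] by auto
  have "(\<Sum>i\<in>I. \<Sum>_<x i. f i) = (\<Sum>u\<in>?U. f (fst u))"
    using assms by (subst sum.Sigma) (auto intro: sum.cong)
  moreover have "(\<Sum>j\<in>J. \<Sum>_<y j. g j) = (\<Sum>v\<in>?V. g (fst v))"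
    using assms by (subst sum.Sigma) (auto intro: sum.cong)
  moreover have "\<dots> = (\<Sum>u\<in>?U. g (fst (b u)))"
    using sum.reindex_bij_betw[OF b, of "\<lambda>v. g (fst v)"] by simp
  ultimately have "(\<Sum>i\<in>I. \<Sum>_<x i. f i) + (\<Sum>j\<in>J. \<Sum>_<y j. g j) =
      (\<Sum>u\<in>?U. f (fst u) + g (fst (b u)))"
    by (simp add: sum.distrib)
  also have "\<dots> \<in> semigroup_gen A"
  proof (intro semigroup_gen_sum semigroup_gen_incl A)
    fix u assume u: "u \<in> ?U"
    then have "b u \<in> ?V" using b by (auto simp: bij_betw_def)
    then show "fst u \<in> I" "fst (b u) \<in> J" using u by auto
  qed
  finally show ?thesis .
qed

lemma sum_even_odd:
  fixes f :: "nat \<Rightarrow> 'a::comm_monoid_add"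
  shows "(\<Sum>k=1..2 * m. f k) = (\<Sum>i=1..m. f (2 * i)) + (\<Sum>i=1..m. f (2 * i - 1))"
  by (induction m) (simp_all add: algebra_simps)

text \<open>Coefficients are attached to indices instead of to elements, so coincidences among the
  generators do no harm.\<close>

lemma semigroup_gen_images_cases:
  fixes R1 R2 :: "nat \<Rightarrow> 'a \<Rightarrow>\<^sub>0 int"
  assumes "x \<in> semigroup_gen (R1 ` {1..M} \<union> R2 ` {1..N} \<union> {t})"
  obtains a b :: "nat \<Rightarrow> int" and c :: nat where
    "x = (\<Sum>h=1..M. frag_cmul (a h) (R1 h)) + (\<Sum>h=1..N. frag_cmul (b h) (R2 h)) +
         frag_cmul (int c) t"
proof -
  have "\<exists>(a :: nat \<Rightarrow> int) (b :: nat \<Rightarrow> int) c.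
    x = (\<Sum>h=1..M. frag_cmul (a h) (R1 h)) + (\<Sum>h=1..N. frag_cmul (b h) (R2 h)) +
         frag_cmul (int c) t"
    using assms
  proof induction
    case zero
    have "0 = (\<Sum>h=1..M. frag_cmul 0 (R1 h)) + (\<Sum>h=1..N. frag_cmul 0 (R2 h)) +
         frag_cmul (int 0) t" by simp
    then show ?case by (intro exI)
  next
    case (add y x)
    then obtain a b c where
      x: "x = (\<Sum>h=1..M. frag_cmul (a h) (R1 h)) + (\<Sum>h=1..N. frag_cmul (b h) (R2 h)) +
         frag_cmul (int c) t" by blast
    have unit: "(\<Sum>h=1..L. frag_cmul ((d(k := d k + 1)) h) (R h)) =
        R k + (\<Sum>h=1..L. frag_cmul (d h) (R h))" if "k \<in> {1..L}"
      for k L and d :: "nat \<Rightarrow> int" and R :: "nat \<Rightarrow> 'a \<Rightarrow>\<^sub>0 int"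
      using that by (simp add: sum.remove[where x = k] frag_cmul_distrib add.assoc)
    consider k where "k \<in> {1..M}" "y = R1 k" | k where "k \<in> {1..N}" "y = R2 k" | "y = t"
      using add.hyps by auto
    then show ?case
    proof cases
      case (1 k)
      show ?thesis
        by (rule exI[of _ "a(k := a k + 1)"], intro exI[of _ b] exI[of _ c])
          (simp only: x unit[OF 1(1)] 1(2) add.assoc)
    next
      case (2 k)
      show ?thesis
        by (intro exI[of _ a] exI[of _ "b(k := b k + 1)"] exI[of _ c])
          (simp only: x unit[OF 2(1)] 2(2) add.assoc add.left_commute)
    next
      case 3
      show ?thesis
        by (intro exI[of _ a] exI[of _ b] exI[of _ "Suc c"])
          (simp add: x 3 frag_cmul_distrib algebra_simps)
    qed
  qed
  then show thesis using that by blast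
qed


text \<open>The functionals \<open>T k \<mapsto> \<lceil>k / 2\<rceil>\<close> and \<open>T k \<mapsto> k mod 2\<close> both vanish on the roots of the
  chain; evaluating them on the combination recovers \<open>n\<close> and \<open>c\<close> from its coefficients.\<close>

lemma chain_root_combination_weights:
  fixes n c :: int and a :: "nat \<Rightarrow> int"
  obtains x :: "nat \<Rightarrow> int" where
    "\<And>T :: nat \<Rightarrow> int. T 0 = 0 \<Longrightarrow>
       (\<Sum>i=1..r + 1. x (2 * i) * T (2 * i)) + (\<Sum>i=1..r + 1. x (2 * i - 1) * T (2 * i - 1)) =
       n * T 2 - (\<Sum>h=1..2 * r. a h * chain_root T h) - c * (T (2 * r + 2) - T (2 * r + 1))"
    and "(\<Sum>i=1..r + 1. x (2 * i) * int i) + (\<Sum>i=1..r + 1. x (2 * i - 1) * int i) = n"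
    and "(\<Sum>i=1..r + 1. x (2 * i - 1)) = c"
proof -
  obtain x :: "nat \<Rightarrow> int" where x: "\<And>T :: nat \<Rightarrow> int. T 0 = 0 \<Longrightarrow>
       (\<Sum>k=1..2 * r + 2. x k * T k) =
       n * T 2 - (\<Sum>h=1..2 * r. a h * chain_root T h) - c * (T (2 * r + 2) - T (2 * r + 1))"
    using chain_root_combination by blast
  have *: "(\<Sum>i=1..r + 1. x (2 * i) * T (2 * i)) + (\<Sum>i=1..r + 1. x (2 * i - 1) * T (2 * i - 1)) =
       n * T 2 - (\<Sum>h=1..2 * r. a h * chain_root T h) - c * (T (2 * r + 2) - T (2 * r + 1))"
    if "T 0 = 0" for T :: "nat \<Rightarrow> int"
    using x[of T] that sum_even_odd[of "\<lambda>k. x k * T k" "r + 1"] by (simp del: sum.cl_ivl_Suc)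
  \<comment> \<open>For this weight \<open>T 2\<close> has value 1, while
    \<open>T (2 * r + 1)\<close> and \<open>T (2 * r + 2)\<close> both have value
    \<open>r + 1\<close>; only \<open>n\<close> survives on the right.\<close>
  have "chain_root (\<lambda>k. int ((k + 1) div 2)) h = 0" if "h \<ge> 1" for h
  proof -
    from that have "h - 1 + 1 = h" "(h + 2 + 1) div 2 = (h + 1) div 2 + 1"
      "(h + 1 + 1) div 2 = h div 2 + 1" by auto
    then show ?thesis unfolding chain_root_def by presburger
  qed
  then have "(\<Sum>i=1..r + 1. x (2 * i) * int ((2 * i + 1) div 2)) +
      (\<Sum>i=1..r + 1. x (2 * i - 1) * int ((2 * i - 1 + 1) div 2)) = n"
    using *[of "\<lambda>k. int ((k + 1) div 2)"] by (simp del: sum.cl_ivl_Suc)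
  moreover have "(\<Sum>i=1..r + 1. x (2 * i - 1) * int ((2 * i - 1 + 1) div 2)) =
      (\<Sum>i=1..r + 1. x (2 * i - 1) * int i)"
    by (intro sum.cong) auto
  ultimately have n: "(\<Sum>i=1..r + 1. x (2 * i) * int i) + (\<Sum>i=1..r + 1. x (2 * i - 1) * int i) = n"
    by (simp del: sum.cl_ivl_Suc)
  \<comment> \<open>For parity \<open>T 2\<close> has value 0 and the last difference has value -1,
    which leaves \<open>c\<close>.\<close>
  have "chain_root (\<lambda>k. int (k mod 2)) h = 0" if "h \<ge> 1" for h
  proof -
    from that obtain m where "h = m + 1" by (metis add.commute le_Suc_ex)
    moreover have "(m + 1 + 1) mod 2 = m mod 2" "(m + 1 + 2) mod 2 = (m + 1) mod 2"
      by presburger+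
    ultimately show ?thesis
      unfolding chain_root_def by (simp only: add_diff_cancel_right')
  qed
  then have "(\<Sum>i=1..r + 1. x (2 * i) * int (2 * i mod 2)) +
      (\<Sum>i=1..r + 1. x (2 * i - 1) * int ((2 * i - 1) mod 2)) = c"
    using *[of "\<lambda>k. int (k mod 2)"] by (simp add: mod_Suc del: sum.cl_ivl_Suc)
  moreover have "(\<Sum>i=1..r + 1. x (2 * i - 1) * int ((2 * i - 1) mod 2)) = (\<Sum>i=1..r + 1. x (2 * i - 1))"
  proof (intro sum.cong refl)
    fix i assume "i \<in> {1..r + 1}"
    then have "(2 * i - 1) mod 2 = 1" by (simp, presburger)
    then show "x (2 * i - 1) * int ((2 * i - 1) mod 2) = x (2 * i - 1)" by simp
  qed
  ultimately have "(\<Sum>i=1..r + 1. x (2 * i - 1)) = c"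
    by simp
  from that[OF * n this] show thesis by simp
qed

section \<open>Reading off coefficients at the colors\<close>

lemma tilde_0 [simp]: "tilde N D 0 = 0"
  by (simp add: tilde_def)

lemma keys_tilde: "h \<le> 2 * N + 2 \<Longrightarrow> Poly_Mapping.keys (tilde N D h) \<subseteq> D ` {1..2 * N + 3}"
  using keys_add[of "frag_of (D h)" "frag_of (D (h + 1))"] by (auto simp: tilde_def keys_frag_of)

lemma lookup_tilde_nonneg: "Poly_Mapping.lookup (tilde N D h) C \<ge> 0"
  by (auto simp: tilde_def lookup_add)

text \<open>The color \<open>D (2 * N + 2)\<close> occurs in both of the last two divisors of the
  chain and may be shared by the two chains. Replacing it by \<open>D (2 * N + 3)\<close> gives each
  divisor a color that no other one contains.\<close>

definition leading_color :: "nat \<Rightarrow> nat \<Rightarrow> nat" where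
  "leading_color N k = (if k = 2 * N + 2 then 2 * N + 3 else k)"

lemma lookup_tilde_leading_color:
  assumes "inj_on D {1..2 * N + 3}" "h \<in> {1..2 * N + 2}" "k \<in> {1..2 * N + 2}"
  shows "Poly_Mapping.lookup (tilde N D h) (D (leading_color N k)) = (if h = k then 1 else 0)"
proof -
  have "D u = D v \<longleftrightarrow> u = v" if "u \<in> {1..2 * N + 3}" "v \<in> {1..2 * N + 3}" for u v
    using assms(1) that by (auto simp: inj_on_def)
  with assms(2,3) show ?thesis
    by (auto simp: tilde_def leading_color_def lookup_add)
qed

lemma lookup_tilde_outside:
  "C \<notin> D ` {1..2 * N + 3} \<Longrightarrow> h \<le> 2 * N + 2 \<Longrightarrow> Poly_Mapping.lookup (tilde N D h) C = 0"
  using keys_tilde[of h N D] by (auto simp: not_in_keys_iff_lookup_eq_zero[symmetric])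

text \<open>The leading color singles out the term \<open>h = k\<close> in its own chain and is
  absent from the other. Effectivity of a divisor thereby becomes nonnegativity of its coefficients
  along the chains.\<close>

lemma leading_coefficient:
  fixes x y :: "nat \<Rightarrow> int"
  assumes "inj_on D {1..2 * N + 3}" "k \<in> {1..2 * N + 2}" "D (leading_color N k) \<notin> D' ` {1..2 * M + 3}"
  shows "(\<Sum>h=1..2 * (N + 1). x h * Poly_Mapping.lookup (tilde N D h) (D (leading_color N k))) +
    (\<Sum>h=1..2 * (M + 1). y h * Poly_Mapping.lookup (tilde M D' h) (D (leading_color N k))) = x k"
proof -
  have "(\<Sum>h=1..2 * (N + 1). x h * Poly_Mapping.lookup (tilde N D h) (D (leading_color N k))) =
      (\<Sum>h=1..2 * (N + 1). if h = k then x h else 0)"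
    using assms by (intro sum.cong) (auto simp: lookup_tilde_leading_color)
  also have "\<dots> = x k" using assms(2) by simp
  finally have "(\<Sum>h=1..2 * (N + 1). x h * Poly_Mapping.lookup (tilde N D h) (D (leading_color N k))) = x k" .
  moreover have "(\<Sum>h=1..2 * (M + 1). y h * Poly_Mapping.lookup (tilde M D' h) (D (leading_color N k))) = 0"
    using assms(3) by (intro sum.neutral) (auto simp: lookup_tilde_outside)
  ultimately show ?thesis by simp
qed

text \<open>The combinatorial core, with colors as mere labels. The assumption \<open>disj\<close>
  permits a shared color without requiring one, which covers both \<open>p = r + s + 2\<close> and
  larger \<open>p\<close>.\<close>

lemma two_chain_semigroup:
  fixes D1 D2 :: "nat \<Rightarrow> 'a"
  assumes inj: "inj_on D1 {1..2 * r + 3}" "inj_on D2 {1..2 * s + 3}"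
    and disj: "\<And>h h'. h \<in> {1..2 * r + 3} \<Longrightarrow> h' \<in> {1..2 * s + 3} \<Longrightarrow> D1 h = D2 h' \<Longrightarrow>
      h = 2 * r + 2 \<and> h' = 2 * s + 2"
  defines "T1 \<equiv> tilde r D1" and "T2 \<equiv> tilde s D2"
  defines "S \<equiv> chain_root T1 ` {1..2 * r} \<union> chain_root T2 ` {1..2 * s} \<union>
    {T1 (2 * r + 2) - T1 (2 * r + 1) + (T2 (2 * s + 2) - T2 (2 * s + 1))}"
  shows "{(n\<^sub>1, n\<^sub>2, E). Poly_Mapping.keys E \<subseteq> D1 ` {1..2 * r + 3} \<union> D2 ` {1..2 * s + 3} \<and>
      (\<forall>C. Poly_Mapping.lookup E C \<ge> 0) \<and>
      frag_cmul (int n\<^sub>1) (T1 2) + frag_cmul (int n\<^sub>2) (T2 2) - E \<in> semigroup_gen S} =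
    semigroup_gen
      ({(i, 0, T1 (2 * i)) | i. 1 \<le> i \<and> i \<le> r + 1} \<union>
       {(0, j, T2 (2 * j)) | j. 1 \<le> j \<and> j \<le> s + 1} \<union>
       {(i, j, T1 (2 * i - 1) + T2 (2 * j - 1)) | i j.
          1 \<le> i \<and> i \<le> r + 1 \<and> 1 \<le> j \<and> j \<le> s + 1})" (is "?\<Gamma> = semigroup_gen ?G")
proof (rule antisym)
  \<comment> \<open>Multiples are written as repeated sums, the form in which the inequalities of
    the chains are stated.\<close>
  have cmul_sum: "frag_cmul (int n) F = (\<Sum>_<n. F)" for n and F :: "'a \<Rightarrow>\<^sub>0 int"
    by (rule poly_mapping_eqI) (simp add: lookup_sum)
  have T0: "T1 0 = 0" "T2 0 = 0" by (simp_all add: T1_def T2_def)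
  have S: "\<And>h. h \<in> {1..2 * r} \<Longrightarrow> chain_root T1 h \<in> S" "\<And>h. h \<in> {1..2 * s} \<Longrightarrow> chain_root T2 h \<in> S"
    by (auto simp: S_def)
  have keys1: "Poly_Mapping.keys (T1 k) \<subseteq> D1 ` {1..2 * r + 3}" if "k \<le> 2 * r + 2" for k
    unfolding T1_def using that by (rule keys_tilde)
  have keys2: "Poly_Mapping.keys (T2 k) \<subseteq> D2 ` {1..2 * s + 3}" if "k \<le> 2 * s + 2" for k
    unfolding T2_def using that by (rule keys_tilde)
  have nonneg: "Poly_Mapping.lookup (T1 k) C \<ge> 0" "Poly_Mapping.lookup (T2 k) C \<ge> 0" for k C
    by (simp_all add: T1_def T2_def lookup_tilde_nonneg)
  show "semigroup_gen ?G \<subseteq> ?\<Gamma>"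
  proof (rule semigroup_gen_least)
    show "0 \<in> ?\<Gamma>" by (simp add: zero_prod_def semigroup_gen.zero)
  next
    fix u v assume "u \<in> ?\<Gamma>" "v \<in> ?\<Gamma>"
    then obtain n1 n2 E m1 m2 F where uv: "u = (n1, n2, E)" "v = (m1, m2, F)"
      and k: "Poly_Mapping.keys E \<subseteq> D1 ` {1..2 * r + 3} \<union> D2 ` {1..2 * s + 3}"
        "Poly_Mapping.keys F \<subseteq> D1 ` {1..2 * r + 3} \<union> D2 ` {1..2 * s + 3}"
      and l: "\<forall>C. Poly_Mapping.lookup E C \<ge> 0" "\<forall>C. Poly_Mapping.lookup F C \<ge> 0"
      and g: "frag_cmul (int n1) (T1 2) + frag_cmul (int n2) (T2 2) - E \<in> semigroup_gen S"
        "frag_cmul (int m1) (T1 2) + frag_cmul (int m2) (T2 2) - F \<in> semigroup_gen S"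
      by auto
    have "Poly_Mapping.keys (E + F) \<subseteq> D1 ` {1..2 * r + 3} \<union> D2 ` {1..2 * s + 3}"
      using k keys_add[of E F] by blast
    with l semigroup_gen_plus[OF g] show "u + v \<in> ?\<Gamma>"
      by (simp add: uv lookup_add frag_cmul_distrib algebra_simps)
  next
    have mem: "(n1, n2, E) \<in> ?\<Gamma>"
      if "Poly_Mapping.keys E \<subseteq> D1 ` {1..2 * r + 3} \<union> D2 ` {1..2 * s + 3}"
        and "\<And>C. Poly_Mapping.lookup E C \<ge> 0"
        and "(\<Sum>_<n1. T1 2) + (\<Sum>_<n2. T2 2) - E \<in> semigroup_gen S" for n1 n2 E
      using that by (simp add: cmul_sum)
    show "?G \<subseteq> ?\<Gamma>"
    proof
      fix w assume "w \<in> ?G"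
      then consider i where "1 \<le> i" "i \<le> r + 1" "w = (i, 0, T1 (2 * i))"
        | j where "1 \<le> j" "j \<le> s + 1" "w = (0, j, T2 (2 * j))"
        | i j where "1 \<le> i" "i \<le> r + 1" "1 \<le> j" "j \<le> s + 1"
            "w = (i, j, T1 (2 * i - 1) + T2 (2 * j - 1))"
        by blast
      then show "w \<in> ?\<Gamma>"
      proof cases
        case (1 i)
        have "(i, 0, T1 (2 * i)) \<in> ?\<Gamma>"
          using keys1[of "2 * i"] chain_even_le[of r T1 S i] S T0 1
          by (intro mem) (auto simp: nonneg)
        with 1 show ?thesis by simp
      next
        case (2 j)
        have "(0, j, T2 (2 * j)) \<in> ?\<Gamma>"
          using keys2[of "2 * j"] chain_even_le[of s T2 S j] S T0 2
          by (intro mem) (auto simp: nonneg)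
        with 2 show ?thesis by simp
      next
        case (3 i j)
        \<comment> \<open>A single \<tau> supplies the final differences of both chains at once;
          this is why odd terms occur only in pairs, one from each chain.\<close>
        have "(T1 (2 * r + 2) - T1 (2 * r + 1) + (T2 (2 * s + 2) - T2 (2 * s + 1))) +
          (((\<Sum>_<i. T1 2) - T1 (2 * i - 1) - (T1 (2 * r + 2) - T1 (2 * r + 1))) +
           ((\<Sum>_<j. T2 2) - T2 (2 * j - 1) - (T2 (2 * s + 2) - T2 (2 * s + 1)))) \<in> semigroup_gen S"
          using 3 by (intro semigroup_gen.add semigroup_gen_plus chain_odd_le S T0) (auto simp: S_def)
        then have "(\<Sum>_<i. T1 2) + (\<Sum>_<j. T2 2) - (T1 (2 * i - 1) + T2 (2 * j - 1)) \<in> semigroup_gen S"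
          by (simp add: algebra_simps)
        moreover have "Poly_Mapping.keys (T1 (2 * i - 1) + T2 (2 * j - 1)) \<subseteq>
            D1 ` {1..2 * r + 3} \<union> D2 ` {1..2 * s + 3}"
        proof -
          have "2 * i - 1 \<le> 2 * r + 2" "2 * j - 1 \<le> 2 * s + 2" using 3 by auto
          from keys1[OF this(1)] keys2[OF this(2)] keys_add[of "T1 (2 * i - 1)" "T2 (2 * j - 1)"]
          show ?thesis by blast
        qed
        ultimately have "(i, j, T1 (2 * i - 1) + T2 (2 * j - 1)) \<in> ?\<Gamma>"
          by (intro mem) (simp_all add: lookup_add nonneg)
        with 3 show ?thesis by simp
      qed
    qed
  qed
  show "?\<Gamma> \<subseteq> semigroup_gen ?G"
  proof
    fix w assume "w \<in> ?\<Gamma>"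
    then obtain n1 n2 E where w: "w = (n1, n2, E)" and E: "\<forall>C. Poly_Mapping.lookup E C \<ge> 0"
      and "frag_cmul (int n1) (T1 2) + frag_cmul (int n2) (T2 2) - E \<in> semigroup_gen S"
      by blast
    then obtain a b :: "nat \<Rightarrow> int" and c :: nat where
      abc: "frag_cmul (int n1) (T1 2) + frag_cmul (int n2) (T2 2) - E =
        (\<Sum>h=1..2 * r. frag_cmul (a h) (chain_root T1 h)) +
        (\<Sum>h=1..2 * s. frag_cmul (b h) (chain_root T2 h)) +
        frag_cmul (int c) (T1 (2 * r + 2) - T1 (2 * r + 1) + (T2 (2 * s + 2) - T2 (2 * s + 1)))"
      unfolding S_def by (elim semigroup_gen_images_cases)
    obtain x :: "nat \<Rightarrow> int" where x: "\<And>T :: nat \<Rightarrow> int. T 0 = 0 \<Longrightarrow>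
       (\<Sum>i=1..r + 1. x (2 * i) * T (2 * i)) + (\<Sum>i=1..r + 1. x (2 * i - 1) * T (2 * i - 1)) =
       int n1 * T 2 - (\<Sum>h=1..2 * r. a h * chain_root T h) - int c * (T (2 * r + 2) - T (2 * r + 1))"
      and xn: "(\<Sum>i=1..r + 1. x (2 * i) * int i) + (\<Sum>i=1..r + 1. x (2 * i - 1) * int i) = int n1"
      and xc: "(\<Sum>i=1..r + 1. x (2 * i - 1)) = int c"
      using chain_root_combination_weights by blast
    \<comment> \<open>The same \<open>c\<close> as for the first chain: it is the multiplicity of
      \<tau>, and \<open>xc\<close> and \<open>yc\<close> tie the odd parts of the two chains
      together.\<close>
    obtain y :: "nat \<Rightarrow> int" where y: "\<And>T :: nat \<Rightarrow> int. T 0 = 0 \<Longrightarrow>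
       (\<Sum>i=1..s + 1. y (2 * i) * T (2 * i)) + (\<Sum>i=1..s + 1. y (2 * i - 1) * T (2 * i - 1)) =
       int n2 * T 2 - (\<Sum>h=1..2 * s. b h * chain_root T h) - int c * (T (2 * s + 2) - T (2 * s + 1))"
      and yn: "(\<Sum>i=1..s + 1. y (2 * i) * int i) + (\<Sum>i=1..s + 1. y (2 * i - 1) * int i) = int n2"
      and yc: "(\<Sum>i=1..s + 1. y (2 * i - 1)) = int c"
      using chain_root_combination_weights by blast
    have lookup_root: "Poly_Mapping.lookup (chain_root T h) C = chain_root (\<lambda>k. Poly_Mapping.lookup (T k) C) h"
      for T :: "nat \<Rightarrow> 'a \<Rightarrow>\<^sub>0 int" and h C
      by (simp add: chain_root_def lookup_add lookup_minus)
    have lookup_E: "Poly_Mapping.lookup E C =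
        (\<Sum>i=1..r + 1. x (2 * i) * Poly_Mapping.lookup (T1 (2 * i)) C) +
        (\<Sum>i=1..r + 1. x (2 * i - 1) * Poly_Mapping.lookup (T1 (2 * i - 1)) C) +
        ((\<Sum>j=1..s + 1. y (2 * j) * Poly_Mapping.lookup (T2 (2 * j)) C) +
         (\<Sum>j=1..s + 1. y (2 * j - 1) * Poly_Mapping.lookup (T2 (2 * j - 1)) C))" for C
      using arg_cong[OF abc, of "\<lambda>F. Poly_Mapping.lookup F C"]
        x[of "\<lambda>k. Poly_Mapping.lookup (T1 k) C"] y[of "\<lambda>k. Poly_Mapping.lookup (T2 k) C"] T0
      by (simp add: lookup_add lookup_minus lookup_sum lookup_root ring_distribs del: sum.cl_ivl_Suc)
    have lookup_E': "Poly_Mapping.lookup E C =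
        (\<Sum>h=1..2 * (r + 1). x h * Poly_Mapping.lookup (T1 h) C) +
        (\<Sum>h=1..2 * (s + 1). y h * Poly_Mapping.lookup (T2 h) C)" for C
      unfolding sum_even_odd by (rule lookup_E)
    have x0: "x k \<ge> 0" if "k \<in> {1..2 * r + 2}" for k
    proof -
      \<comment> \<open>The index \<open>2 * r + 2\<close> is the only one at which a color of the
        first chain can also belong to the second.\<close>
      have "leading_color r k \<in> {1..2 * r + 3} - {2 * r + 2}"
        using that by (auto simp: leading_color_def)
      then have "D1 (leading_color r k) \<notin> D2 ` {1..2 * s + 3}"
        using disj by blast
      from leading_coefficient[OF inj(1) that this, of x y]
      have "Poly_Mapping.lookup E (D1 (leading_color r k)) = x k"
        unfolding lookup_E' T1_def T2_def .
      with E show ?thesis by metis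
    qed
    have y0: "y k \<ge> 0" if "k \<in> {1..2 * s + 2}" for k
    proof -
      have "leading_color s k \<in> {1..2 * s + 3} - {2 * s + 2}"
        using that by (auto simp: leading_color_def)
      then have "D2 (leading_color s k) \<notin> D1 ` {1..2 * r + 3}"
        using disj by (metis DiffD1 DiffD2 image_iff singletonI)
      from leading_coefficient[OF inj(2) that this, of y x]
      have "Poly_Mapping.lookup E (D2 (leading_color s k)) = y k"
        unfolding lookup_E' T1_def T2_def by (subst add.commute)
      with E show ?thesis by metis
    qed
    have x_nat: "x (2 * i) = int (nat (x (2 * i)))" "x (2 * i - 1) = int (nat (x (2 * i - 1)))"
      if "i \<in> {1..r + 1}" for i
    proof -
      have "2 * i \<in> {1..2 * r + 2}" "2 * i - 1 \<in> {1..2 * r + 2}" using that by auto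
      with x0 show "x (2 * i) = int (nat (x (2 * i)))" "x (2 * i - 1) = int (nat (x (2 * i - 1)))"
        by (metis nat_0_le)+
    qed
    have y_nat: "y (2 * i) = int (nat (y (2 * i)))" "y (2 * i - 1) = int (nat (y (2 * i - 1)))"
      if "i \<in> {1..s + 1}" for i
    proof -
      have "2 * i \<in> {1..2 * s + 2}" "2 * i - 1 \<in> {1..2 * s + 2}" using that by auto
      with y0 show "y (2 * i) = int (nat (y (2 * i)))" "y (2 * i - 1) = int (nat (y (2 * i - 1)))"
        by (metis nat_0_le)+
    qed
    \<comment> \<open>Here \<open>?p\<close> and \<open>?q\<close> consist of generators. The terms
      of \<open>?u\<close> and \<open>?v\<close> are the two halves of mixed generators and enter
      the semigroup only after being paired.\<close>
    let ?p = "\<Sum>i=1..r + 1. \<Sum>_<nat (x (2 * i)). (i, 0 :: nat, T1 (2 * i))"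
    let ?q = "\<Sum>j=1..s + 1. \<Sum>_<nat (y (2 * j)). (0 :: nat, j, T2 (2 * j))"
    let ?u = "\<Sum>i=1..r + 1. \<Sum>_<nat (x (2 * i - 1)). (i, 0 :: nat, T1 (2 * i - 1))"
    let ?v = "\<Sum>j=1..s + 1. \<Sum>_<nat (y (2 * j - 1)). (0 :: nat, j, T2 (2 * j - 1))"
    \<comment> \<open>With \<open>f = id\<close> these compute the first two components of the
      triples, with \<open>f\<close> constantly 1 the numbers of odd terms.\<close>
    have sums: "int (\<Sum>i=1..r + 1. nat (x (2 * i)) * f i) = (\<Sum>i=1..r + 1. x (2 * i) * int (f i))"
      "int (\<Sum>i=1..r + 1. nat (x (2 * i - 1)) * f i) = (\<Sum>i=1..r + 1. x (2 * i - 1) * int (f i))"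
      "int (\<Sum>i=1..s + 1. nat (y (2 * i)) * f i) = (\<Sum>i=1..s + 1. y (2 * i) * int (f i))"
      "int (\<Sum>i=1..s + 1. nat (y (2 * i - 1)) * f i) = (\<Sum>i=1..s + 1. y (2 * i - 1) * int (f i))"
      for f
      unfolding of_nat_sum of_nat_mult by (intro sum.cong refl; simp only: x_nat[symmetric] y_nat[symmetric])+
    have "(n1, n2, E) = ?p + (?q + (?u + ?v))"
    proof (intro prod_eqI)
      have "int n1 = int (fst (?p + (?q + (?u + ?v))))"
        using xn sums(1,2)[of id] by (simp add: fst_sum del: sum.cl_ivl_Suc)
      then show "fst (n1, n2, E) = fst (?p + (?q + (?u + ?v)))" by simp
      have "int n2 = int (fst (snd (?p + (?q + (?u + ?v)))))"
        using yn sums(3,4)[of id] by (simp add: fst_sum snd_sum del: sum.cl_ivl_Suc)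
      then show "fst (snd (n1, n2, E)) = fst (snd (?p + (?q + (?u + ?v))))" by simp
      have "Poly_Mapping.lookup (snd (snd (?p + (?q + (?u + ?v))))) C = Poly_Mapping.lookup E C" for C
      proof -
        have "Poly_Mapping.lookup (snd (snd (?p + (?q + (?u + ?v))))) C =
          (\<Sum>i=1..r + 1. int (nat (x (2 * i))) * Poly_Mapping.lookup (T1 (2 * i)) C) +
          ((\<Sum>j=1..s + 1. int (nat (y (2 * j))) * Poly_Mapping.lookup (T2 (2 * j)) C) +
          ((\<Sum>i=1..r + 1. int (nat (x (2 * i - 1))) * Poly_Mapping.lookup (T1 (2 * i - 1)) C) +
           (\<Sum>j=1..s + 1. int (nat (y (2 * j - 1))) * Poly_Mapping.lookup (T2 (2 * j - 1)) C)))"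
          by (simp add: snd_sum lookup_add lookup_sum del: sum.cl_ivl_Suc of_nat_nat int_nat_eq)
        also have "\<dots> = Poly_Mapping.lookup E C"
          unfolding lookup_E by (simp only: x_nat[symmetric] y_nat[symmetric] add_ac cong: sum.cong)
        finally show ?thesis .
      qed
      then show "snd (snd (n1, n2, E)) = snd (snd (?p + (?q + (?u + ?v))))"
        by (intro poly_mapping_eqI) (simp only: snd_conv)
    qed
    also have "\<dots> \<in> semigroup_gen ?G"
    proof -
      have p: "?p \<in> semigroup_gen ?G" and q: "?q \<in> semigroup_gen ?G"
        by (intro semigroup_gen_sum semigroup_gen_incl; force)+
      have "int (\<Sum>i=1..r + 1. nat (x (2 * i - 1))) = int (\<Sum>j=1..s + 1. nat (y (2 * j - 1)))"
        using sums(2)[of "\<lambda>_. 1"] sums(4)[of "\<lambda>_. 1"] xc yc by (simp del: sum.cl_ivl_Suc)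
      then have "(\<Sum>i=1..r + 1. nat (x (2 * i - 1))) = (\<Sum>j=1..s + 1. nat (y (2 * j - 1)))"
        unfolding of_nat_eq_iff .
      then have "?u + ?v \<in> semigroup_gen ?G"
        by (rule semigroup_gen_balanced_sum[rotated 2]) force+
      with p q show ?thesis by (intro semigroup_gen_plus[of ?p] semigroup_gen_plus[of ?q])
    qed
    finally show "w \<in> semigroup_gen ?G"
      unfolding w .
  qed
qed

section \<open>Application to the wonderful variety\<close>

theorem proposition4p8:
  fixes p q r s :: nat
    and \<rho> :: "mat_pair \<Rightarrow> complex^'n^'n" and X :: "(complex^'n) set" and x\<^sub>0 :: "complex^'n"
    and D1 D2 :: "nat \<Rightarrow> (complex^'n) set"
  assumes "r > 0" and "s > 0" and "r + s < q - 1" and "r + s \<le> p - 2"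
    and wonderful: "wonderful_compactification p q \<rho> X x\<^sub>0
          (normalizer (SGL p q)
             (stabilizer (SGL p q) (isotropy_act p q) (nilpotent_rep p q r s)))"
    and Sigma: "spherical_roots p q \<rho> X =
          root_char p q ` (sigma1 p ` {1..2 * r}) \<union> root_char p q ` (sigma2 q ` {1..2 * s}) \<union>
          {tau_char p q r s}"
    and Delta: "colors p q \<rho> X = D1 ` {1..2 * r + 3} \<union> D2 ` {1..2 * s + 3}"
    and chain1: "color_chain p q \<rho> X r (sigma1 p) (Alpha (p - r - 1)) D1"
    and chain2: "color_chain p q \<rho> X s (sigma2 q) (Alpha (s + 1)) D2"
    and last_colors: "r + s < q - 2 \<Longrightarrow>
          {C \<in> colors p q \<rho> X. moves p q \<rho> (Alpha' (r + 1)) C} = {D1 (2 * r + 3)} \<and>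
          {C \<in> colors p q \<rho> X. moves p q \<rho> (Alpha' (q - s - 1)) C} = {D2 (2 * s + 3)}"
    and last_colors_simple: "r + s = q - 2 \<Longrightarrow>
          {C \<in> colors p q \<rho> X. moves p q \<rho> (Alpha' (r + 1)) C} = {D1 (2 * r + 3), D2 (2 * s + 3)} \<and>
          Poly_Mapping.lookup (root_class p q \<rho> X (root_char p q (Alpha' r))) (D1 (2 * r + 3)) = -1 \<and>
          Poly_Mapping.lookup (root_class p q \<rho> X (root_char p q (Alpha' (q - s)))) (D2 (2 * s + 3)) = -1"
    and distinct1: "inj_on D1 {1..2 * r + 3}"
    and distinct2: "inj_on D2 {1..2 * s + 3}"
    and distinct12: "\<And>h h'. h \<in> {1..2 * r + 3} \<Longrightarrow> h' \<in> {1..2 * s + 3} \<Longrightarrow>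
          D1 h = D2 h' \<longleftrightarrow> p = r + s + 2 \<and> h = 2 * r + 2 \<and> h' = 2 * s + 2"
    and sigma1_class: "\<And>h. h \<in> {1..2 * r} \<Longrightarrow>
          root_class p q \<rho> X (root_char p q (sigma1 p h)) =
            - tilde r D1 (h - 1) + tilde r D1 h + tilde r D1 (h + 1) - tilde r D1 (h + 2)"
    and sigma2_class: "\<And>h. h \<in> {1..2 * s} \<Longrightarrow>
          root_class p q \<rho> X (root_char p q (sigma2 q h)) =
            - tilde s D2 (h - 1) + tilde s D2 h + tilde s D2 (h + 1) - tilde s D2 (h + 2)"
    and tau_class: "root_class p q \<rho> X (tau_char p q r s) =
            - frag_of (D1 (2 * r + 1)) + frag_of (D1 (2 * r + 3)) + frag_of (D2 (2 * s + 3)) -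
              frag_of (D2 (2 * s + 1))"
    and D_p1: "D_p1 p q \<rho> X x\<^sub>0 (nilpotent_rep p q r s) = frag_of (D1 2)"
    and D_p2: "D_p2 p q \<rho> X x\<^sub>0 (nilpotent_rep p q r s) = frag_of (D2 2)"
  shows "Gamma_p p q \<rho> X x\<^sub>0 (nilpotent_rep p q r s) =
         semigroup_gen
           ({(i, 0, tilde r D1 (2 * i)) | i. 1 \<le> i \<and> i \<le> r + 1} \<union>
            {(0, j, tilde s D2 (2 * j)) | j. 1 \<le> j \<and> j \<le> s + 1} \<union>
            {(i, j, tilde r D1 (2 * i - 1) + tilde s D2 (2 * j - 1)) | i j.
               1 \<le> i \<and> i \<le> r + 1 \<and> 1 \<le> j \<and> j \<le> s + 1})"
proof -
  let ?T1 = "tilde r D1" and ?T2 = "tilde s D2"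
  define S where "S = chain_root ?T1 ` {1..2 * r} \<union> chain_root ?T2 ` {1..2 * s} \<union>
    {?T1 (2 * r + 2) - ?T1 (2 * r + 1) + (?T2 (2 * s + 2) - ?T2 (2 * s + 1))}"
  have "root_class p q \<rho> X ` (root_char p q ` (sigma1 p ` {1..2 * r})) = chain_root ?T1 ` {1..2 * r}"
    "root_class p q \<rho> X ` (root_char p q ` (sigma2 q ` {1..2 * s})) = chain_root ?T2 ` {1..2 * s}"
    unfolding image_image using sigma1_class sigma2_class
    by (auto simp: chain_root_def intro!: image_cong)
  \<comment> \<open>The middle color \<open>D1 (2 * r + 2)\<close> cancels in the difference of the
    last two divisors of its chain, as does \<open>D2 (2 * s + 2)\<close> in the other.\<close>
  moreover have "root_class p q \<rho> X (tau_char p q r s) =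
      ?T1 (2 * r + 2) - ?T1 (2 * r + 1) + (?T2 (2 * s + 2) - ?T2 (2 * s + 1))"
    unfolding tau_class by (simp add: tilde_def numeral_eq_Suc)
  ultimately have S: "root_class p q \<rho> X ` spherical_roots p q \<rho> X = S"
    unfolding Sigma S_def by (simp only: image_Un image_insert image_empty)
  \<comment> \<open>As \<open>r\<close> and \<open>s\<close> are positive, the index 2 stays below
    \<open>2 * r + 1\<close> and \<open>2 * s + 1\<close>, where \<open>tilde\<close> is a single
    color.\<close>
  have D: "D_p1 p q \<rho> X x\<^sub>0 (nilpotent_rep p q r s) = ?T1 2"
    "D_p2 p q \<rho> X x\<^sub>0 (nilpotent_rep p q r s) = ?T2 2"
    using \<open>r > 0\<close> \<open>s > 0\<close> by (simp_all add: D_p1 D_p2 tilde_def)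
  show ?thesis
    unfolding Gamma_p_def effective_colors_def le_Sigma_def Delta S D mem_Collect_eq conj_assoc
    unfolding S_def using distinct12 by (intro two_chain_semigroup distinct1 distinct2) blast
qed

end
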